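(* Let $\mathbb{M}$ be a monster model of a complete $C$-minimal expansion of ACVF whose language contains a constant symbol $t$ with $v(t)>0$. Let $D\subseteq\mathrm{RV}^2$ be definable, and let $X$ be a fragment whose stabilizer $\mathrm{Stab}(X)=\{(u,w)\in\mathrm{RV}^2:(u,w)\cdot X=X\}$ is finite. Then the set of $(a,b)\in\Gamma^2$ such that $D\cap(\mathrm{RV}_a\times\mathrm{RV}_b)=(u,w)\cdot X$ for some $(u,w)\in\mathrm{RV}^2$ is finite.
   Context: ACVF is the theory of algebraically closed non-trivially valued fields; $C$-minimal means every definable subset of the home sort is a finite boolean combination of balls and points. "Definable" means with parameters. $\Gamma$ is the value group, $\mathfrak m$ the maximal ideal, $k$ the residue field (strongly minimal). $\mathrm{RV}=\mathbb{M}^\times/(1+\mathfrak m)$, a multiplicative group with a surjection $\mathrm{RV}\to\Gamma$ induced by $v$, kernel $k^\times$, fibers $\mathrm{RV}_\gamma$. Each $\mathrm{RV}_a\times\mathrm{RV}_b$ is in definable bijection with $(k^\times)^2$ by translation, and $\dim$ of a definable subset is Morley rank of its image in $(k^\times)^2$. A fragment is a non-empty definable set $X\subseteq\mathrm{RV}_a\times\mathrm{RV}_b$ for some $(a,b)\in\Gamma^2$ with $\dim(X)<2$. $\mathrm{RV}^2$ acts on itself by coordinatewise multiplication. *)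

theory Defs
  imports
    "HOL-Library.Extended_Real"
    "HOL-Algebra.Algebra"
begin

unbundle cardinal_syntax

section \<open>First-order logic\<close>

text \<open>A language over the symbol types \<open>'f\<close> and \<open>'r\<close> consists of those symbols that are given an
  arity; constant symbols are function symbols of arity 0.\<close>

record ('f, 'r) lang =
  fun_ar :: "'f \<Rightarrow> nat option"
  rel_ar :: "'r \<Rightarrow> nat option"

datatype 'f trm = Var nat | App 'f "'f trm list"

datatype ('f, 'r) form =
    Eq "'f trm" "'f trm"
  | Rel 'r "'f trm list"
  | Neg "('f, 'r) form"
  | And "('f, 'r) form" "('f, 'r) form"
  | Ex nat "('f, 'r) form"

fun fv_trm :: "'f trm \<Rightarrow> nat set" where
  "fv_trm (Var i) = {i}"
| "fv_trm (App f ts) = (\<Union>s\<in>set ts. fv_trm s)"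

fun fv :: "('f, 'r) form \<Rightarrow> nat set" where
  "fv (Eq s u) = fv_trm s \<union> fv_trm u"
| "fv (Rel r ts) = (\<Union>s\<in>set ts. fv_trm s)"
| "fv (Neg \<phi>) = fv \<phi>"
| "fv (And \<phi> \<psi>) = fv \<phi> \<union> fv \<psi>"
| "fv (Ex i \<phi>) = fv \<phi> - {i}"

fun wf_trm :: "('f, 'r) lang \<Rightarrow> 'f trm \<Rightarrow> bool" where
  "wf_trm L (Var i) = True"
| "wf_trm L (App f ts) = (fun_ar L f = Some (length ts) \<and> (\<forall>s\<in>set ts. wf_trm L s))"

fun wf_form :: "('f, 'r) lang \<Rightarrow> ('f, 'r) form \<Rightarrow> bool" where
  "wf_form L (Eq s u) = (wf_trm L s \<and> wf_trm L u)"
| "wf_form L (Rel r ts) = (rel_ar L r = Some (length ts) \<and> (\<forall>s\<in>set ts. wf_trm L s))"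
| "wf_form L (Neg \<phi>) = wf_form L \<phi>"
| "wf_form L (And \<phi> \<psi>) = (wf_form L \<phi> \<and> wf_form L \<psi>)"
| "wf_form L (Ex i \<phi>) = wf_form L \<phi>"

definition sentence :: "('f, 'r) lang \<Rightarrow> ('f, 'r) form \<Rightarrow> bool" where
  "sentence L \<phi> \<longleftrightarrow> wf_form L \<phi> \<and> fv \<phi> = {}"

text \<open>The universe of a structure is the whole type \<open>'a\<close>. Only the values at symbols of the language
  and at argument lists of the correct length matter.\<close>

record ('a, 'f, 'r) struct =
  fun_int :: "'f \<Rightarrow> 'a list \<Rightarrow> 'a"
  rel_int :: "'r \<Rightarrow> 'a list \<Rightarrow> bool"

fun trm_val :: "('a, 'f, 'r) struct \<Rightarrow> (nat \<Rightarrow> 'a) \<Rightarrow> 'f trm \<Rightarrow> 'a" where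
  "trm_val M e (Var i) = e i"
| "trm_val M e (App f ts) = fun_int M f (map (trm_val M e) ts)"

fun sat :: "('a, 'f, 'r) struct \<Rightarrow> (nat \<Rightarrow> 'a) \<Rightarrow> ('f, 'r) form \<Rightarrow> bool" where
  "sat M e (Eq s u) = (trm_val M e s = trm_val M e u)"
| "sat M e (Rel r ts) = rel_int M r (map (trm_val M e) ts)"
| "sat M e (Neg \<phi>) = (\<not> sat M e \<phi>)"
| "sat M e (And \<phi> \<psi>) = (sat M e \<phi> \<and> sat M e \<psi>)"
| "sat M e (Ex i \<phi>) = (\<exists>x. sat M (e(i := x)) \<phi>)"

definition is_model :: "('a, 'f, 'r) struct \<Rightarrow> ('f, 'r) form set \<Rightarrow> bool" where
  "is_model M T \<longleftrightarrow> (\<forall>\<phi>\<in>T. \<forall>e. sat M e \<phi>)"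

definition is_theory :: "('f, 'r) lang \<Rightarrow> ('f, 'r) form set \<Rightarrow> bool" where
  "is_theory L T \<longleftrightarrow> (\<forall>\<phi>\<in>T. sentence L \<phi>)"

text \<open>HOL cannot quantify over all types inside a formula, so properties of a theory that refer to
  all of its models refer to all models with universe \<open>'a\<close>. They are used for a type \<open>'a\<close> which is
  infinite and has at least as many elements as there are formulas; by the Loewenheim-Skolem
  theorems the properties below then do not depend on \<open>'a\<close>.\<close>

definition entails :: "'a itself \<Rightarrow> ('f, 'r) form set \<Rightarrow> ('f, 'r) form \<Rightarrow> bool" where
  "entails (_ :: 'a itself) T \<phi> \<longleftrightarrow>
     (\<forall>M :: ('a, 'f, 'r) struct. is_model M T \<longrightarrow> (\<forall>e. sat M e \<phi>))"

definition complete_theory ::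
  "'a itself \<Rightarrow> ('f, 'r) lang \<Rightarrow> ('f, 'r) form set \<Rightarrow> bool" where
  "complete_theory (_ :: 'a itself) L T \<longleftrightarrow>
     is_theory L T \<and>
     (\<exists>M :: ('a, 'f, 'r) struct. is_model M T) \<and>
     (\<forall>\<phi>. sentence L \<phi> \<longrightarrow> entails TYPE('a) T \<phi> \<or> entails TYPE('a) T (Neg \<phi>))"

text \<open>Subsets of \<open>M\<^sup>n\<close> definable with parameters: the coordinates of the tuple are the values of the
  variables \<open>0, \<dots>, n - 1\<close>, and the assignment \<open>e\<close> supplies parameters for all other variables.\<close>

definition definable ::
  "('f, 'r) lang \<Rightarrow> ('a, 'f, 'r) struct \<Rightarrow> nat \<Rightarrow> 'a list set \<Rightarrow> bool" where
  "definable L M n S \<longleftrightarrow>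
     (\<exists>\<phi> e. wf_form L \<phi> \<and>
        S = {xs. length xs = n \<and> sat M (\<lambda>i. if i < n then xs ! i else e i) \<phi>})"

section \<open>Monster models\<close>

text \<open>A formula in the single variable 0 with parameters in \<open>A\<close> is a pair of a formula and an
  assignment with values in \<open>A\<close> at all other free variables.\<close>

definition saturated ::
  "('f, 'r) lang \<Rightarrow> ('a, 'f, 'r) struct \<Rightarrow> 'k rel \<Rightarrow> bool" where
  "saturated L M \<kappa> \<longleftrightarrow>
     (\<forall>A :: 'a set. \<forall>p :: (('f, 'r) form \<times> (nat \<Rightarrow> 'a)) set.
        |A| <o \<kappa> \<and>
        (\<forall>(\<phi>, e)\<in>p. wf_form L \<phi> \<and> (\<forall>i\<in>fv \<phi> - {0}. e i \<in> A)) \<and>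
        (\<forall>q\<subseteq>p. finite q \<longrightarrow> (\<exists>x. \<forall>(\<phi>, e)\<in>q. sat M (e(0 := x)) \<phi>)) \<longrightarrow>
        (\<exists>x. \<forall>(\<phi>, e)\<in>p. sat M (e(0 := x)) \<phi>))"

definition partial_elementary ::
  "('f, 'r) lang \<Rightarrow> ('a, 'f, 'r) struct \<Rightarrow> 'a set \<Rightarrow> ('a \<Rightarrow> 'a) \<Rightarrow> bool" where
  "partial_elementary L M A h \<longleftrightarrow>
     (\<forall>\<phi> e. wf_form L \<phi> \<and> (\<forall>i\<in>fv \<phi>. e i \<in> A) \<longrightarrow> (sat M e \<phi> \<longleftrightarrow> sat M (h \<circ> e) \<phi>))"

definition automorphism ::
  "('f, 'r) lang \<Rightarrow> ('a, 'f, 'r) struct \<Rightarrow> ('a \<Rightarrow> 'a) \<Rightarrow> bool" where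
  "automorphism L M \<sigma> \<longleftrightarrow>
     bij \<sigma> \<and>
     (\<forall>f xs. fun_ar L f = Some (length xs) \<longrightarrow> \<sigma> (fun_int M f xs) = fun_int M f (map \<sigma> xs)) \<and>
     (\<forall>r xs. rel_ar L r = Some (length xs) \<longrightarrow> (rel_int M r xs \<longleftrightarrow> rel_int M r (map \<sigma> xs)))"

definition strongly_homogeneous ::
  "('f, 'r) lang \<Rightarrow> ('a, 'f, 'r) struct \<Rightarrow> 'k rel \<Rightarrow> bool" where
  "strongly_homogeneous L M \<kappa> \<longleftrightarrow>
     (\<forall>(A :: 'a set) h. |A| <o \<kappa> \<and> partial_elementary L M A h \<longrightarrow>
        (\<exists>\<sigma>. automorphism L M \<sigma> \<and> (\<forall>x\<in>A. \<sigma> x = h x)))"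

text \<open>An infinite \<open>\<kappa>\<close>-saturated structure has at least \<open>\<kappa>\<close> elements, so \<open>\<kappa>\<close> may be taken on the
  type \<open>'a\<close>. The number of formulas is the cardinality of the language plus \<open>\<aleph>\<^sub>0\<close>.\<close>

definition monster_model ::
  "('f, 'r) lang \<Rightarrow> ('f, 'r) form set \<Rightarrow> ('a, 'f, 'r) struct \<Rightarrow> bool" where
  "monster_model L T M \<longleftrightarrow>
     is_model M T \<and>
     (\<exists>\<kappa> :: 'a rel. Card_order \<kappa> \<and> |{\<phi>. wf_form L \<phi>}| <o \<kappa> \<and>
        saturated L M \<kappa> \<and> strongly_homogeneous L M \<kappa>)"

section \<open>Algebraically closed valued fields\<close>

text \<open>The one-sorted language of valued fields: the language of rings with a binary relation symbol
  \<open>Div\<close> for \<open>v x \<le> v y\<close>, plus arbitrary further symbols.\<close>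

datatype 'f vf_fun = Zero | One | Uminus | Plus | Times | Extra_fun 'f
datatype 'r vf_rel = Div | Extra_rel 'r

definition expands_vf_lang :: "('f vf_fun, 'r vf_rel) lang \<Rightarrow> bool" where
  "expands_vf_lang L \<longleftrightarrow>
     fun_ar L Zero = Some 0 \<and> fun_ar L One = Some 0 \<and> fun_ar L Uminus = Some 1 \<and>
     fun_ar L Plus = Some 2 \<and> fun_ar L Times = Some 2 \<and> rel_ar L Div = Some 2"

type_synonym ('a, 'f, 'r) vf_struct = "('a, 'f vf_fun, 'r vf_rel) struct"

definition fld :: "('a, 'f, 'r) vf_struct \<Rightarrow> 'a ring" where
  "fld M = \<lparr>carrier = UNIV,
     monoid.mult = (\<lambda>x y. fun_int M Times [x, y]), monoid.one = fun_int M One [],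
     ring.zero = fun_int M Zero [], ring.add = (\<lambda>x y. fun_int M Plus [x, y])\<rparr>"

definition vle :: "('a, 'f, 'r) vf_struct \<Rightarrow> 'a \<Rightarrow> 'a \<Rightarrow> bool" where
  "vle M x y \<longleftrightarrow> rel_int M Div [x, y]"

text \<open>The conditions on \<open>vle\<close> say that it is \<open>v x \<le> v y\<close> for a non-trivial valuation \<open>v\<close> of the field,
  with \<open>v 0 = \<infinity>\<close>; in particular the maximal ideal \<open>{x. v x > 0}\<close> below contains 0.\<close>

definition is_ACVF :: "('a, 'f, 'r) vf_struct \<Rightarrow> bool" where
  "is_ACVF M \<longleftrightarrow>
     algebraically_closed (fld M) \<and>
     (\<forall>x. fun_int M Uminus [x] = \<ominus>\<^bsub>fld M\<^esub> x) \<and>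
     (\<forall>x y. vle M x y \<or> vle M y x) \<and>
     (\<forall>x y z. vle M x y \<longrightarrow> vle M y z \<longrightarrow> vle M x z) \<and>
     (\<forall>x y z. vle M x y \<longrightarrow> vle M (x \<otimes>\<^bsub>fld M\<^esub> z) (y \<otimes>\<^bsub>fld M\<^esub> z)) \<and>
     (\<forall>x y z. vle M z x \<longrightarrow> vle M z y \<longrightarrow> vle M z (x \<oplus>\<^bsub>fld M\<^esub> y)) \<and>
     \<not> vle M \<zero>\<^bsub>fld M\<^esub> \<one>\<^bsub>fld M\<^esub> \<and>
     (\<exists>x. x \<noteq> \<zero>\<^bsub>fld M\<^esub> \<and> \<not> vle M x \<one>\<^bsub>fld M\<^esub>)"

definition expansion_of_ACVF ::
  "'a itself \<Rightarrow> ('f vf_fun, 'r vf_rel) lang \<Rightarrow> ('f vf_fun, 'r vf_rel) form set \<Rightarrow> bool" where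
  "expansion_of_ACVF (_ :: 'a itself) L T \<longleftrightarrow>
     expands_vf_lang L \<and> (\<forall>M :: ('a, 'f, 'r) vf_struct. is_model M T \<longrightarrow> is_ACVF M)"

section \<open>C-minimality\<close>

definition open_ball :: "('a, 'f, 'r) vf_struct \<Rightarrow> 'a \<Rightarrow> 'a \<Rightarrow> 'a set" where
  "open_ball M c r = {x. \<not> vle M (x \<ominus>\<^bsub>fld M\<^esub> c) r}"

definition closed_ball :: "('a, 'f, 'r) vf_struct \<Rightarrow> 'a \<Rightarrow> 'a \<Rightarrow> 'a set" where
  "closed_ball M c r = {x. vle M r (x \<ominus>\<^bsub>fld M\<^esub> c)}"

text \<open>Balls have their radii \<open>v r\<close> in the value group, whence \<open>r \<noteq> 0\<close>.\<close>

definition balls_and_points :: "('a, 'f, 'r) vf_struct \<Rightarrow> 'a set set" where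
  "balls_and_points M =
     {open_ball M c r |c r. r \<noteq> \<zero>\<^bsub>fld M\<^esub>} \<union>
     {closed_ball M c r |c r. r \<noteq> \<zero>\<^bsub>fld M\<^esub>} \<union>
     {{c} |c. True}"

inductive_set bool_combs :: "'a set set \<Rightarrow> 'a set set" for \<B> where
  base: "B \<in> \<B> \<Longrightarrow> B \<in> bool_combs \<B>"
| compl: "B \<in> bool_combs \<B> \<Longrightarrow> - B \<in> bool_combs \<B>"
| union: "B \<in> bool_combs \<B> \<Longrightarrow> C \<in> bool_combs \<B> \<Longrightarrow> B \<union> C \<in> bool_combs \<B>"

definition C_minimal :: "('f vf_fun, 'r vf_rel) lang \<Rightarrow> ('a, 'f, 'r) vf_struct \<Rightarrow> bool" where
  "C_minimal L M \<longleftrightarrow>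
     (\<forall>S. definable L M 1 ((\<lambda>x. [x]) ` S) \<longrightarrow> S \<in> bool_combs (balls_and_points M))"

definition C_minimal_theory ::
  "'a itself \<Rightarrow> ('f vf_fun, 'r vf_rel) lang \<Rightarrow> ('f vf_fun, 'r vf_rel) form set \<Rightarrow> bool" where
  "C_minimal_theory (_ :: 'a itself) L T \<longleftrightarrow>
     (\<forall>M :: ('a, 'f, 'r) vf_struct. is_model M T \<longrightarrow> C_minimal L M)"

section \<open>The value group and RV\<close>

definition mgrp :: "('a, 'f, 'r) vf_struct \<Rightarrow> 'a monoid" where
  "mgrp M = Multiplicative_Group.mult_of (fld M)"

definition max_ideal :: "('a, 'f, 'r) vf_struct \<Rightarrow> 'a set" where
  "max_ideal M = {x. \<not> vle M x \<one>\<^bsub>fld M\<^esub>}"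

definition val_units :: "('a, 'f, 'r) vf_struct \<Rightarrow> 'a set" where
  "val_units M = {x. vle M x \<one>\<^bsub>fld M\<^esub> \<and> vle M \<one>\<^bsub>fld M\<^esub> x}"

definition one_units :: "('a, 'f, 'r) vf_struct \<Rightarrow> 'a set" where
  "one_units M = {\<one>\<^bsub>fld M\<^esub> \<oplus>\<^bsub>fld M\<^esub> x |x. x \<in> max_ideal M}"

text \<open>The value group is written multiplicatively, as the quotient of the multiplicative group by the
  units of the valuation ring. Its order plays no role below.\<close>

definition Gam :: "('a, 'f, 'r) vf_struct \<Rightarrow> 'a set monoid" where
  "Gam M = mgrp M Mod val_units M"

definition val :: "('a, 'f, 'r) vf_struct \<Rightarrow> 'a \<Rightarrow> 'a set" where
  "val M x = val_units M #>\<^bsub>mgrp M\<^esub> x"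

definition RV :: "('a, 'f, 'r) vf_struct \<Rightarrow> 'a set monoid" where
  "RV M = mgrp M Mod one_units M"

definition rv :: "('a, 'f, 'r) vf_struct \<Rightarrow> 'a \<Rightarrow> 'a set" where
  "rv M x = one_units M #>\<^bsub>mgrp M\<^esub> x"

definition val_RV :: "('a, 'f, 'r) vf_struct \<Rightarrow> 'a set \<Rightarrow> 'a set" where
  "val_RV M u = the_elem (val M ` u)"

definition RV_fib :: "('a, 'f, 'r) vf_struct \<Rightarrow> 'a set \<Rightarrow> 'a set set" where
  "RV_fib M a = {u \<in> carrier (RV M). val_RV M u = a}"

text \<open>The multiplicative group of the residue field, as a subgroup of \<open>RV\<close>.\<close>

definition res_units :: "('a, 'f, 'r) vf_struct \<Rightarrow> 'a set set" where
  "res_units M = kernel (RV M) (Gam M) (val_RV M)"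

definition RV2 :: "('a, 'f, 'r) vf_struct \<Rightarrow> ('a set \<times> 'a set) monoid" where
  "RV2 M = RV M \<times>\<times> RV M"

text \<open>\<open>RV\<close> is an imaginary sort: a subset of \<open>RV\<^sup>2\<close> is definable iff its preimage in the home sort is.\<close>

definition definable_RV2 ::
  "('f vf_fun, 'r vf_rel) lang \<Rightarrow> ('a, 'f, 'r) vf_struct \<Rightarrow> ('a set \<times> 'a set) set \<Rightarrow> bool" where
  "definable_RV2 L M S \<longleftrightarrow>
     S \<subseteq> carrier (RV2 M) \<and>
     definable L M 2
       {[x, y] |x y. x \<noteq> \<zero>\<^bsub>fld M\<^esub> \<and> y \<noteq> \<zero>\<^bsub>fld M\<^esub> \<and> (rv M x, rv M y) \<in> S}"

section \<open>Dimension and fragments\<close>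

text \<open>\<open>morley_rank_ge L M n S\<close> says that the definable set \<open>S\<close> has Morley rank at least \<open>n\<close>, computed
  with definable sets of the (saturated) structure itself.\<close>

fun morley_rank_ge ::
  "('f vf_fun, 'r vf_rel) lang \<Rightarrow> ('a, 'f, 'r) vf_struct \<Rightarrow> nat \<Rightarrow> ('a set \<times> 'a set) set \<Rightarrow> bool"
where
  "morley_rank_ge L M 0 S \<longleftrightarrow> S \<noteq> {}"
| "morley_rank_ge L M (Suc n) S \<longleftrightarrow>
     (\<exists>F :: nat \<Rightarrow> ('a set \<times> 'a set) set.
        (\<forall>i. definable_RV2 L M (F i) \<and> F i \<subseteq> S \<and> morley_rank_ge L M n (F i)) \<and>
        (\<forall>i j. i \<noteq> j \<longrightarrow> F i \<inter> F j = {}))"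

text \<open>The rank of the empty set is \<open>-\<infinity>\<close>, and all infinite ranks are identified with \<open>\<infinity>\<close>.\<close>

definition morley_rank ::
  "('f vf_fun, 'r vf_rel) lang \<Rightarrow> ('a, 'f, 'r) vf_struct \<Rightarrow> ('a set \<times> 'a set) set \<Rightarrow> ereal" where
  "morley_rank L M S = Sup {ereal (real n) |n. morley_rank_ge L M n S}"

text \<open>Translation by the inverse of any element of \<open>RV_fib M a \<times> RV_fib M b\<close> maps
  \<open>S \<subseteq> RV_fib M a \<times> RV_fib M b\<close> into \<open>res_units M \<times> res_units M\<close>; Morley rank is
  translation invariant, so the choice does not matter.\<close>

definition RV_dim ::
  "('f vf_fun, 'r vf_rel) lang \<Rightarrow> ('a, 'f, 'r) vf_struct \<Rightarrow> 'a set \<Rightarrow> 'a set \<Rightarrow>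
     ('a set \<times> 'a set) set \<Rightarrow> ereal" where
  "RV_dim L M a b S =
     (let g = (SOME g. g \<in> RV_fib M a \<times> RV_fib M b)
      in morley_rank L M (inv\<^bsub>RV2 M\<^esub> g <#\<^bsub>RV2 M\<^esub> S))"

definition fragment ::
  "('f vf_fun, 'r vf_rel) lang \<Rightarrow> ('a, 'f, 'r) vf_struct \<Rightarrow> ('a set \<times> 'a set) set \<Rightarrow> bool" where
  "fragment L M Y \<longleftrightarrow>
     Y \<noteq> {} \<and> definable_RV2 L M Y \<and>
     (\<exists>a\<in>carrier (Gam M). \<exists>b\<in>carrier (Gam M).
        Y \<subseteq> RV_fib M a \<times> RV_fib M b \<and> RV_dim L M a b Y < 2)"

definition Stab :: "('a, 'f, 'r) vf_struct \<Rightarrow> ('a set \<times> 'a set) set \<Rightarrow> ('a set \<times> 'a set) set" where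
  "Stab M Y = {g \<in> carrier (RV2 M). g <#\<^bsub>RV2 M\<^esub> Y = Y}"

end

(* Suppose D and the translates of Y are pulled back to the home sort. The pairs (x, y) such that D
  agrees with (rv x, rv y) Y on the corresponding fibre form a definable set, and over each pair of
  values there are only finitely many classes (rv x, rv y), namely one coset of Stab(Y). By
  C-minimality a definable set in one variable is, away from finitely many values, a union of fibres
  of v, each of which meets infinitely many classes in RV as the residue field is infinite; so a
  definable set meeting only finitely many classes in each fibre has finite image in the value group.
  Applying this to the sections of the set of pairs and then to its first projection gives the result. *)
theory Submission
  imports Defs
begin

section \<open>Relations between assignments\<close>

fun ren_trm :: "(nat \<Rightarrow> nat) \<Rightarrow> 'f trm \<Rightarrow> 'f trm" where
  "ren_trm f (Var i) = Var (f i)"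
| "ren_trm f (App g ts) = App g (map (ren_trm f) ts)"

text \<open>Bound variables are renamed together with the free ones. For an injective renaming this
  causes no capture, so fresh variables never have to be chosen.\<close>

fun ren :: "(nat \<Rightarrow> nat) \<Rightarrow> ('f, 'r) form \<Rightarrow> ('f, 'r) form" where
  "ren f (Eq s u) = Eq (ren_trm f s) (ren_trm f u)"
| "ren f (Rel r ts) = Rel r (map (ren_trm f) ts)"
| "ren f (Neg \<phi>) = Neg (ren f \<phi>)"
| "ren f (And \<phi> \<psi>) = And (ren f \<phi>) (ren f \<psi>)"
| "ren f (Ex i \<phi>) = Ex (f i) (ren f \<phi>)"

lemma wf_ren_trm: "wf_trm L (ren_trm f t) = wf_trm L t"
  by (induction t) auto

lemma wf_ren: "wf_form L (ren f \<phi>) = wf_form L \<phi>"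
  by (induction \<phi>) (auto simp: wf_ren_trm)

lemma trm_val_ren: "trm_val M e (ren_trm f t) = trm_val M (\<lambda>i. e (f i)) t"
proof (induction t)
  case (App g ts)
  then have "map (trm_val M e \<circ> ren_trm f) ts = map (trm_val M (\<lambda>i. e (f i))) ts"
    by simp
  then show ?case by (simp only: ren_trm.simps trm_val.simps map_map)
qed simp

lemma sat_ren:
  assumes "inj f"
  shows "sat M e (ren f \<phi>) = sat M (\<lambda>i. e (f i)) \<phi>"
proof (induction \<phi> arbitrary: e)
  case (Rel r ts)
  have "map (trm_val M e \<circ> ren_trm f) ts = map (trm_val M (\<lambda>i. e (f i))) ts"
    by (simp add: trm_val_ren)
  then show ?case by (simp only: ren.simps sat.simps map_map)
next
  case (Ex i \<phi>)
  have "(\<lambda>j. (e(f i := x)) (f j)) = (\<lambda>j. e (f j))(i := x)" for x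
    using assms by (auto simp: fun_eq_iff inj_eq)
  then show ?case using Ex by simp
qed (simp_all add: trm_val_ren)

section \<open>Closure properties of definable relations\<close>

definition interleave :: "(nat \<Rightarrow> 'a) \<Rightarrow> (nat \<Rightarrow> 'a) \<Rightarrow> nat \<Rightarrow> 'a" where
  "interleave s e i = (if even i then s (i div 2) else e (i div 2))"

lemma interleave_simps [simp]:
  "interleave s e (2 * i) = s i" "interleave s e (Suc (2 * i)) = e i"
  by (simp_all add: interleave_def)

lemma interleave_upd: "interleave (s(i := x)) e = (interleave s e)(2 * i := x)"
  by (auto simp: interleave_def fun_eq_iff)

text \<open>Even variables carry the arguments and odd ones the parameters, so that two relations can be
  combined after moving their parameters to disjoint sets of odd variables.\<close>

definition definable_rel ::
  "('f, 'r) lang \<Rightarrow> ('a, 'f, 'r) struct \<Rightarrow> ((nat \<Rightarrow> 'a) \<Rightarrow> bool) \<Rightarrow> bool" where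
  "definable_rel L M P \<longleftrightarrow>
     (\<exists>\<phi> e. wf_form L \<phi> \<and> (\<forall>s. P s \<longleftrightarrow> sat M (interleave s e) \<phi>))"

lemma definable_relI:
  assumes "wf_form L \<phi>" and "\<And>s. P s \<longleftrightarrow> sat M (interleave s e) \<phi>"
  shows "definable_rel L M P"
  using assms unfolding definable_rel_def by blast

lemma definable_rel_Neg:
  assumes "definable_rel L M P"
  shows "definable_rel L M (\<lambda>s. \<not> P s)"
proof -
  obtain \<phi> e where "wf_form L \<phi>" "\<And>s. P s \<longleftrightarrow> sat M (interleave s e) \<phi>"
    using assms unfolding definable_rel_def by blast
  then show ?thesis by (intro definable_relI[of L "Neg \<phi>" _ M e]) auto
qed

lemma definable_rel_And:
  assumes "definable_rel L M P" and "definable_rel L M Q"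
  shows "definable_rel L M (\<lambda>s. P s \<and> Q s)"
proof -
  obtain \<phi> e where \<phi>: "wf_form L \<phi>" "\<And>s. P s \<longleftrightarrow> sat M (interleave s e) \<phi>"
    using assms(1) unfolding definable_rel_def by blast
  obtain \<psi> e' where \<psi>: "wf_form L \<psi>" "\<And>s. Q s \<longleftrightarrow> sat M (interleave s e') \<psi>"
    using assms(2) unfolding definable_rel_def by blast
  \<comment> \<open>Argument variables stay in place and are shared. Parameter \<open>k\<close> of
    the first formula moves from variable 2k+1 to 4k+1, that of the second to 4k+3, which is where
    \<open>interleave s (interleave e e')\<close> keeps their values.\<close>
  define f where "f i = (if even i then i else Suc (2 * (2 * (i div 2))))" for i :: nat
  define g where "g i = (if even i then i else Suc (2 * Suc (2 * (i div 2))))" for i :: nat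
  have inj: "inj f" "inj g"
    unfolding f_def g_def inj_def by (auto split: if_splits) presburger+
  have "(\<lambda>i. interleave s (interleave e e') (f i)) = interleave s e"
    "(\<lambda>i. interleave s (interleave e e') (g i)) = interleave s e'" for s
    unfolding f_def g_def by (auto simp: fun_eq_iff interleave_def elim!: oddE)
  then show ?thesis
    using \<phi> \<psi> inj
    by (intro definable_relI[of L "And (ren f \<phi>) (ren g \<psi>)" _ M "interleave e e'"])
      (auto simp: wf_ren sat_ren)
qed

lemma definable_rel_Ex:
  assumes "definable_rel L M P"
  shows "definable_rel L M (\<lambda>s. \<exists>x. P (s(i := x)))"
proof -
  obtain \<phi> e where "wf_form L \<phi>" "\<And>s. P s \<longleftrightarrow> sat M (interleave s e) \<phi>"
    using assms unfolding definable_rel_def by blast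
  then show ?thesis
    by (intro definable_relI[of L "Ex (2 * i) \<phi>" _ M e]) (auto simp: interleave_upd)
qed

lemma definable_rel_imp:
  assumes "definable_rel L M P" and "definable_rel L M Q"
  shows "definable_rel L M (\<lambda>s. P s \<longrightarrow> Q s)"
  using definable_rel_Neg[OF definable_rel_And[OF assms(1) definable_rel_Neg[OF assms(2)]]] by simp

lemma definable_rel_iff:
  assumes "definable_rel L M P" and "definable_rel L M Q"
  shows "definable_rel L M (\<lambda>s. P s \<longleftrightarrow> Q s)"
  using definable_rel_And[OF definable_rel_imp[OF assms] definable_rel_imp[OF assms(2,1)]]
  by (simp add: iff_conv_conj_imp)

lemma definable_rel_All:
  assumes "definable_rel L M P"
  shows "definable_rel L M (\<lambda>s. \<forall>x. P (s(i := x)))"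
  using definable_rel_Neg[OF definable_rel_Ex[OF definable_rel_Neg[OF assms]]] by simp

lemma definable_rel_eq_const: "definable_rel L M (\<lambda>s. s i = c)"
  by (rule definable_relI[of L "Eq (Var (2 * i)) (Var 1)" _ M "\<lambda>_. c"])
    (simp_all add: interleave_def)

lemma definable_rel_eq_var: "definable_rel L M (\<lambda>s. s i = s j)"
  by (rule definable_relI[of L "Eq (Var (2 * i)) (Var (2 * j))"]) simp_all

text \<open>Substituting amounts to quantifying over a value that an equation ties to
  \<open>c\<close>, so formulas need no substitution operation.\<close>

lemma definable_rel_subst_const:
  assumes "definable_rel L M P"
  shows "definable_rel L M (\<lambda>s. P (s(i := c)))"
  using definable_rel_Ex[OF definable_rel_And[OF definable_rel_eq_const[of _ _ i c] assms], of i]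
  by simp

lemma definable_rel_subst_var:
  assumes "definable_rel L M P" and "i \<noteq> j"
  shows "definable_rel L M (\<lambda>s. P (s(i := s j)))"
  using definable_rel_Ex[OF definable_rel_And[OF definable_rel_eq_var[of _ _ i j] assms(1)], of i]
    assms(2) by simp

lemma definable_rel_mem2:
  assumes "definable L M 2 S" and "i \<noteq> j"
  shows "definable_rel L M (\<lambda>s. [s i, s j] \<in> S)"
proof -
  obtain \<phi> e where \<phi>: "wf_form L \<phi>"
    and S: "S = {xs. length xs = 2 \<and> sat M (\<lambda>i. if i < 2 then xs ! i else e i) \<phi>}"
    using assms(1) unfolding definable_def by blast
  \<comment> \<open>Variables 0 and 1 carry the coordinates of the tuple and go to the argument
    slots of \<open>i\<close> and \<open>j\<close>. All other variables are parameters and go to odd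
    slots. The map is injective because \<open>i \<noteq> j\<close>.\<close>
  define f where "f k = (if k = 0 then 2 * i else if k = 1 then 2 * j else Suc (2 * k))" for k
  have inj: "inj f"
    using assms(2) unfolding f_def inj_def by (auto split: if_splits) presburger+
  have "(\<lambda>k. if k < 2 then [s i, s j] ! k else e k) = (\<lambda>k. interleave s e (f k))" for s
    by (auto simp: fun_eq_iff f_def less_2_cases_iff)
  then show ?thesis
    using \<phi> inj by (intro definable_relI[of L "ren f \<phi>" _ M e]) (auto simp: S wf_ren sat_ren)
qed

lemma definable_rel_imp_definable:
  assumes "definable_rel L M (\<lambda>s. P (s 0))"
  shows "definable L M 1 ((\<lambda>x. [x]) ` Collect P)"
proof -
  obtain \<phi> e where \<phi>: "wf_form L \<phi>" "\<And>s. P (s 0) \<longleftrightarrow> sat M (interleave s e) \<phi>"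
    using assms unfolding definable_rel_def by blast
  \<comment> \<open>The truth value depends on argument 0 only, so the other argument slots can be
    frozen at arbitrary values; those of \<open>e\<close> are taken.\<close>
  let ?e = "interleave e e"
  have *: "P x \<longleftrightarrow> sat M (\<lambda>i. if i < 1 then [x] ! i else ?e i) \<phi>" for x
  proof -
    have "(\<lambda>i. if i < 1 then [x] ! i else ?e i) = interleave (e(0 := x)) e"
      by (auto simp: fun_eq_iff interleave_def)
    then show ?thesis using \<phi>(2)[of "e(0 := x)"] by simp
  qed
  have "(\<lambda>x. [x]) ` Collect P =
      {xs. length xs = 1 \<and> sat M (\<lambda>i. if i < 1 then xs ! i else ?e i) \<phi>}" (is "_ = ?R")
  proof (intro equalityI subsetI)
    fix xs assume "xs \<in> ?R"
    then obtain x where "xs = [x]" by (auto simp: length_Suc_conv)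
    with \<open>xs \<in> ?R\<close> *[of x] show "xs \<in> (\<lambda>x. [x]) ` Collect P" by auto
  next
    fix xs assume "xs \<in> (\<lambda>x. [x]) ` Collect P"
    then show "xs \<in> ?R" using * by auto
  qed
  then show ?thesis
    using \<phi>(1) unfolding definable_def by blast
qed

text \<open>Equality in the value group is phrased on the field, where \<open>Div\<close> is a
  relation symbol, so that it can occur inside formulas.\<close>

definition veq :: "('a, 'f, 'r) vf_struct \<Rightarrow> 'a \<Rightarrow> 'a \<Rightarrow> bool" where
  "veq M x y \<longleftrightarrow> vle M x y \<and> vle M y x"

lemma definable_rel_veq:
  assumes "expands_vf_lang L"
  shows "definable_rel L M (\<lambda>s. veq M (s i) c)"
proof -
  have vle: "definable_rel L M (\<lambda>s. vle M (s j) (s k))" for j k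
    using assms
    by (intro definable_relI[of L "Rel Div [Var (2 * j), Var (2 * k)]"])
      (auto simp: expands_vf_lang_def vle_def)
  have "definable_rel L M (\<lambda>s. veq M (s i) (s (Suc i)))"
    unfolding veq_def by (intro definable_rel_And vle)
  from definable_rel_subst_const[OF this, of "Suc i" c] show ?thesis by simp
qed

lemma definable_rel_subst_mult:
  assumes "expands_vf_lang L" and "definable_rel L M P" and "i \<noteq> j" and "i \<noteq> k"
  shows "definable_rel L M (\<lambda>s. P (s(i := s j \<otimes>\<^bsub>fld M\<^esub> s k)))"
proof -
  have "definable_rel L M (\<lambda>s. s i = s j \<otimes>\<^bsub>fld M\<^esub> s k)"
    using assms(1)
    by (intro definable_relI[of L "Eq (Var (2 * i)) (App Times [Var (2 * j), Var (2 * k)])"])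
      (auto simp: expands_vf_lang_def fld_def)
  from definable_rel_Ex[OF definable_rel_And[OF this assms(2)], of i] show ?thesis
    using assms(3,4) by simp
qed

text \<open>To be used with \<open>z\<close> zero and with the preimages of \<open>D\<close> and of
  the fragment as \<open>A\<close> and \<open>B\<close>. Quantifying over representatives
  \<open>x\<close>, \<open>y\<close> with the values of \<open>c\<close>, \<open>d\<close> takes the
  place of quantifying over a product of fibres of RV.\<close>

lemma definable_rel_translate:
  assumes L: "expands_vf_lang L" and A: "definable L M 2 A" and B: "definable L M 2 B"
  shows "definable_rel L M (\<lambda>s. s 0 \<noteq> z \<and> s 1 \<noteq> z \<and>
           (\<forall>x y. veq M x c \<longrightarrow> veq M y d \<longrightarrow>
              ([s 0 \<otimes>\<^bsub>fld M\<^esub> x, s 1 \<otimes>\<^bsub>fld M\<^esub> y] \<in> A \<longleftrightarrow> [x, y] \<in> B)))"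
proof -
  \<comment> \<open>Coordinates 4 and 5 are placeholders for the two products; 2 and 3 hold
    \<open>x\<close> and \<open>y\<close> until they are quantified away.\<close>
  have "definable_rel L M (\<lambda>s. [s 4, s 5] \<in> A)"
    by (rule definable_rel_mem2[OF A]) simp
  from definable_rel_subst_mult[OF L this, of 5 1 3]
  have "definable_rel L M (\<lambda>s. [s 4, s 1 \<otimes>\<^bsub>fld M\<^esub> s 3] \<in> A)" by simp
  from definable_rel_subst_mult[OF L this, of 4 0 2]
  have A': "definable_rel L M (\<lambda>s. [s 0 \<otimes>\<^bsub>fld M\<^esub> s 2, s 1 \<otimes>\<^bsub>fld M\<^esub> s 3] \<in> A)" by simp
  have B': "definable_rel L M (\<lambda>s. [s 2, s 3] \<in> B)"
    by (rule definable_rel_mem2[OF B]) simp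
  have "definable_rel L M (\<lambda>s. veq M (s 2) c \<longrightarrow> veq M (s 3) d \<longrightarrow>
      ([s 0 \<otimes>\<^bsub>fld M\<^esub> s 2, s 1 \<otimes>\<^bsub>fld M\<^esub> s 3] \<in> A \<longleftrightarrow> [s 2, s 3] \<in> B))"
    by (intro definable_rel_imp definable_rel_iff definable_rel_veq[OF L] A' B')
  from definable_rel_All[OF definable_rel_All[OF this, of 3], of 2]
  show ?thesis
    by (intro definable_rel_And definable_rel_Neg definable_rel_eq_const) simp_all
qed

section \<open>The valuation and RV\<close>

locale acvf = field R for R :: "'a ring" (structure) +
  fixes M :: "('a, 'f, 'r) vf_struct"
  assumes R_def: "R = fld M" and is_ACVF: "is_ACVF M"
begin

lemma in_carrier [simp]: "x \<in> carrier R"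
  by (simp add: R_def fld_def)

lemma algebraically_closed: "algebraically_closed R"
  using is_ACVF by (simp add: is_ACVF_def R_def)

lemma vle_linear: "vle M x y \<or> vle M y x"
  using is_ACVF by (simp add: is_ACVF_def)

lemma vle_refl [simp]: "vle M x x"
  using vle_linear[of x x] by simp

lemma vle_trans: "vle M x y \<Longrightarrow> vle M y z \<Longrightarrow> vle M x z"
  using is_ACVF unfolding is_ACVF_def by blast

lemma vle_mult: "vle M x y \<Longrightarrow> vle M (x \<otimes> z) (y \<otimes> z)"
  using is_ACVF unfolding is_ACVF_def R_def by blast

lemma vle_add: "vle M z x \<Longrightarrow> vle M z y \<Longrightarrow> vle M z (x \<oplus> y)"
  using is_ACVF unfolding is_ACVF_def R_def by blast

lemma not_vle_zero_one: "\<not> vle M \<zero> \<one>"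
  using is_ACVF unfolding is_ACVF_def R_def by blast

lemma inv_closed_nonzero [simp]: "x \<noteq> \<zero> \<Longrightarrow> inv x \<noteq> \<zero>"
  and r_inv_nonzero [simp]: "x \<noteq> \<zero> \<Longrightarrow> x \<otimes> inv x = \<one>"
  and l_inv_nonzero [simp]: "x \<noteq> \<zero> \<Longrightarrow> inv x \<otimes> x = \<one>"
proof -
  show *: "x \<otimes> inv x = \<one>" "inv x \<otimes> x = \<one>" if "x \<noteq> \<zero>" for x
    using that field_Units by auto
  show "inv x \<noteq> \<zero>" if "x \<noteq> \<zero>" for x
    using *(1)[OF that] by auto
qed

lemma vle_mult_cancel: "z \<noteq> \<zero> \<Longrightarrow> vle M (x \<otimes> z) (y \<otimes> z) \<longleftrightarrow> vle M x y"
proof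
  assume z: "z \<noteq> \<zero>" and "vle M (x \<otimes> z) (y \<otimes> z)"
  from vle_mult[OF this(2), of "inv z"] show "vle M x y"
    using z by (simp add: m_assoc)
qed (rule vle_mult)

lemma vle_zero: "vle M x \<zero>"
proof -
  have "vle M \<one> \<zero>"
    using vle_linear not_vle_zero_one by blast
  from vle_mult[OF this, of x] show ?thesis by simp
qed

lemma vle_zero_iff [simp]: "vle M \<zero> x \<longleftrightarrow> x = \<zero>"
  using vle_mult[of "\<zero>" x "inv x"] not_vle_zero_one by (cases "x = \<zero>") auto

text \<open>Multiplying v(-1) \<le> v(1) by -1 turns it into v(1) \<le> v(-1), so by linearity the
  latter holds in any case. Multiplying by \<open>x\<close> gives the claim.\<close>

lemma vle_uminus: "vle M x (\<ominus> x)"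
proof -
  have *: "vle M a (\<ominus> b) \<Longrightarrow> vle M (\<ominus> a) b" for a b
    using vle_mult[of a "\<ominus> b" "\<ominus> \<one>"] by (simp add: l_minus r_minus)
  have "vle M \<one> (\<ominus> \<one>)"
    using vle_linear[of "\<one>" "\<ominus> \<one>"] *[of "\<ominus> \<one>" "\<ominus> \<one>"] *[of "\<one>" "\<ominus> \<one>"]
      vle_mult[of "\<ominus> \<one>" "\<one>" "\<ominus> \<one>"]
    by (auto simp: l_minus r_minus)
  from vle_mult[OF this, of x] show ?thesis by (simp add: l_minus)
qed

lemma vle_minus: "vle M z x \<Longrightarrow> vle M z y \<Longrightarrow> vle M z (x \<ominus> y)"
  unfolding a_minus_def by (metis vle_add vle_trans vle_uminus)

lemma veq_refl [simp]: "veq M x x"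
  by (simp add: veq_def)

lemma veq_sym: "veq M x y \<Longrightarrow> veq M y x"
  by (simp add: veq_def)

lemma veq_trans: "veq M x y \<Longrightarrow> veq M y z \<Longrightarrow> veq M x z"
  unfolding veq_def using vle_trans by blast

lemma veq_mult_cancel: "z \<noteq> \<zero> \<Longrightarrow> veq M (x \<otimes> z) (y \<otimes> z) \<longleftrightarrow> veq M x y"
  by (simp add: veq_def vle_mult_cancel)

lemma veq_mult: "veq M x x' \<Longrightarrow> veq M y y' \<Longrightarrow> veq M (x \<otimes> y) (x' \<otimes> y')"
  unfolding veq_def by (metis vle_mult vle_trans m_comm in_carrier)

lemma veq_zero_iff: "veq M x y \<Longrightarrow> x = \<zero> \<longleftrightarrow> y = \<zero>"
  unfolding veq_def by auto

text \<open>The term of strictly smaller value dominates. The upper bound comes from x = (x - c) +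
  c: since v(c) > v(x), the summand x - c cannot have value above v(x) as well.\<close>

lemma vle_minus_iff:
  assumes "\<not> vle M c x"
  shows "vle M (x \<ominus> c) x \<and> vle M x (x \<ominus> c)"
proof -
  have "vle M x c"
    using assms vle_linear by blast
  then have 1: "vle M x (x \<ominus> c)"
    by (intro vle_minus) auto
  have x: "x = (x \<ominus> c) \<oplus> c"
    by (simp add: a_minus_def a_assoc l_neg)
  have "vle M (x \<ominus> c) c \<or> vle M c (x \<ominus> c)"
    by (rule vle_linear)
  then have "vle M (x \<ominus> c) x"
  proof
    assume "vle M (x \<ominus> c) c"
    then have "vle M (x \<ominus> c) ((x \<ominus> c) \<oplus> c)"
      by (intro vle_add) auto
    then show ?thesis using x by simp
  next
    assume "vle M c (x \<ominus> c)"
    then have "vle M c ((x \<ominus> c) \<oplus> c)"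
      by (intro vle_add) auto
    then show ?thesis using x assms by simp
  qed
  with 1 show ?thesis by simp
qed

lemma veq_minus_left: "\<not> vle M c x \<Longrightarrow> veq M (x \<ominus> c) x"
  using vle_minus_iff by (simp add: veq_def)

lemma veq_uminus: "veq M (\<ominus> x) x"
  using vle_uminus[of x] vle_uminus[of "\<ominus> x"] by (simp add: veq_def)

lemma veq_minus_swap: "veq M (x \<ominus> c) (c \<ominus> x)"
proof -
  have "c \<ominus> x = \<ominus> (x \<ominus> c)"
    by (simp add: a_minus_def minus_add a_comm)
  then show ?thesis using veq_uminus[of "x \<ominus> c"] veq_sym by simp
qed

text \<open>When v(x) and v(c) differ, v(x - c) is the smaller of the two, hence depends on
  \<open>x\<close> only through v(x). This is what controls balls centred at
  \<open>c\<close>.\<close>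

lemma veq_minus_cong:
  assumes "veq M x y" and "\<not> veq M x c"
  shows "veq M (x \<ominus> c) (y \<ominus> c)"
proof (cases "vle M c x")
  case False
  then have "\<not> vle M c y"
    using assms(1) vle_trans unfolding veq_def by blast
  with False show ?thesis
    using veq_minus_left assms(1) veq_trans veq_sym by meson
next
  case True
  then have "\<not> vle M x c" "\<not> vle M y c"
    using assms vle_trans unfolding veq_def by blast+
  then show ?thesis
    using veq_minus_left veq_minus_swap veq_trans veq_sym by meson
qed

section \<open>The value group and RV as groups of cosets\<close>

lemma carrier_mgrp: "carrier (mgrp M) = {x. x \<noteq> \<zero>}"
  and mult_mgrp: "x \<otimes>\<^bsub>mgrp M\<^esub> y = x \<otimes> y"
  and one_mgrp: "\<one>\<^bsub>mgrp M\<^esub> = \<one>"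
  unfolding mgrp_def R_def[symmetric] by (auto simp: Multiplicative_Group.mult_of_simps)

lemma mgrp_comm_group: "comm_group (mgrp M)"
proof (rule comm_groupI)
  fix x assume "x \<in> carrier (mgrp M)"
  then show "\<exists>y\<in>carrier (mgrp M). y \<otimes>\<^bsub>mgrp M\<^esub> x = \<one>\<^bsub>mgrp M\<^esub>"
    by (intro bexI[of _ "inv x"]) (auto simp: carrier_mgrp mult_mgrp one_mgrp)
qed (auto simp: carrier_mgrp mult_mgrp one_mgrp m_ac integral_iff)

lemma mem_val_iff: "x \<noteq> \<zero> \<Longrightarrow> y \<in> val M x \<longleftrightarrow> veq M y x"
proof
  assume x: "x \<noteq> \<zero>"
  show "veq M y x" if "y \<in> val M x"
    using that vle_mult[of _ _ x]
    unfolding val_def val_units_def r_coset_def mult_mgrp R_def[symmetric] veq_def by fastforce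
  assume "veq M y x"
  then have "veq M (y \<otimes> inv x) \<one>"
    using veq_mult[of y x "inv x" "inv x"] x by simp
  moreover have "y = (y \<otimes> inv x) \<otimes> x"
    using x by (simp add: m_assoc)
  ultimately show "y \<in> val M x"
    unfolding val_def val_units_def r_coset_def mult_mgrp R_def[symmetric] veq_def by blast
qed

lemma val_eq_iff: "x \<noteq> \<zero> \<Longrightarrow> y \<noteq> \<zero> \<Longrightarrow> val M x = val M y \<longleftrightarrow> veq M x y"
  unfolding set_eq_iff using mem_val_iff veq_refl veq_sym veq_trans by meson

text \<open>Writing y = (1 + m)x gives m = (y - x)/x, and \<open>m\<close> lies in the maximal ideal
  iff v(y - x) > v(x). The inequality replaces coset computations from here on in the subgroup proof
  and in \<open>rv_eq_iff\<close>.\<close>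

lemma mem_rv_iff: "x \<noteq> \<zero> \<Longrightarrow> y \<in> rv M x \<longleftrightarrow> \<not> vle M (y \<ominus> x) x"
proof
  assume x: "x \<noteq> \<zero>"
  show "\<not> vle M (y \<ominus> x) x" if y: "y \<in> rv M x"
  proof -
    obtain m where m: "\<not> vle M m \<one>" and y: "y = (\<one> \<oplus> m) \<otimes> x"
      using y unfolding rv_def one_units_def max_ideal_def r_coset_def mult_mgrp R_def[symmetric]
      by blast
    have "y \<ominus> x = m \<otimes> x"
      unfolding y a_minus_def by (simp add: l_distr a_ac r_neg1 r_neg2 l_neg r_neg)
    then show ?thesis using vle_mult_cancel[OF x, of m \<one>] m by simp
  qed
  assume *: "\<not> vle M (y \<ominus> x) x"
  define m where "m = (y \<ominus> x) \<otimes> inv x"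
  have mx: "m \<otimes> x = y \<ominus> x"
    using x by (simp add: m_def m_assoc)
  then have "\<not> vle M m \<one>"
    using * vle_mult_cancel[OF x, of m \<one>] by simp
  moreover have "y = (\<one> \<oplus> m) \<otimes> x"
    by (simp add: l_distr mx) (simp add: a_minus_def a_lcomm[of x] r_neg)
  ultimately show "y \<in> rv M x"
    unfolding rv_def one_units_def max_ideal_def r_coset_def mult_mgrp R_def[symmetric] by blast
qed

text \<open>Here \<open>y\<close> is \<open>x\<close> minus an element of strictly larger value, so
  \<open>veq_minus_left\<close> applies.\<close>

lemma mem_rv_imp_veq: "x \<noteq> \<zero> \<Longrightarrow> y \<in> rv M x \<Longrightarrow> veq M y x"
proof -
  assume "x \<noteq> \<zero>" "y \<in> rv M x"
  then have "\<not> vle M (y \<ominus> x) x"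
    using mem_rv_iff by simp
  then have "\<not> vle M (x \<ominus> y) x"
    using veq_minus_swap[of y x] vle_trans unfolding veq_def by blast
  then have "veq M (x \<ominus> (x \<ominus> y)) x"
    by (rule veq_minus_left)
  moreover have "x \<ominus> (x \<ominus> y) = y"
    by (simp add: a_minus_def minus_add a_assoc[symmetric] r_neg)
  ultimately show ?thesis by simp
qed

text \<open>As the class of 1, this set is given by v(x - 1) > 0, and its elements have value 0.
  Closure then follows from (1/x - 1)x = 1 - x and xy - 1 = (x - 1)y + (y - 1).\<close>

lemma one_units_subgroup: "subgroup (one_units M) (mgrp M)"
proof -
  interpret G: comm_group "mgrp M" by (rule mgrp_comm_group)
  have rv1: "one_units M = rv M \<one>"
    unfolding rv_def r_coset_def mult_mgrp by simp
  have mem: "x \<in> one_units M \<longleftrightarrow> \<not> vle M (x \<ominus> \<one>) \<one>" for x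
    unfolding rv1 by (rule mem_rv_iff) simp
  have veq1: "veq M x \<one>" if "x \<in> one_units M" for x
    using that mem_rv_imp_veq[of "\<one>" x] rv1 by simp
  show ?thesis
  proof (rule G.subgroupI)
    show sub: "one_units M \<subseteq> carrier (mgrp M)"
      using veq1 veq_zero_iff by (fastforce simp: carrier_mgrp)
    have "\<one> \<in> one_units M"
      unfolding mem by (simp add: a_minus_def r_neg)
    then show "one_units M \<noteq> {}" by blast
    fix x assume x: "x \<in> one_units M"
    then have nz: "x \<noteq> \<zero>" using sub by (auto simp: carrier_mgrp)
    have inv: "inv\<^bsub>mgrp M\<^esub> x = inv x"
      using nz by (intro G.inv_equality) (auto simp: carrier_mgrp mult_mgrp one_mgrp)
    have "(inv x \<ominus> \<one>) \<otimes> x = \<one> \<ominus> x"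
      using nz by (simp add: a_minus_def l_distr l_minus)
    moreover have "\<not> vle M (\<one> \<ominus> x) x"
      using x veq1[OF x] veq_minus_swap[of x \<one>] vle_trans unfolding mem veq_def by blast
    ultimately have "\<not> vle M (inv x \<ominus> \<one>) \<one>"
      using vle_mult_cancel[OF nz, of "inv x \<ominus> \<one>" \<one>] by simp
    then show "inv\<^bsub>mgrp M\<^esub> x \<in> one_units M"
      unfolding inv mem .
    fix y assume y: "y \<in> one_units M"
    have eq: "x \<otimes> y \<ominus> \<one> = (x \<ominus> \<one>) \<otimes> y \<oplus> (y \<ominus> \<one>)"
      by (simp add: a_minus_def l_distr l_minus) (simp add: a_ac r_neg1 r_neg2 l_neg r_neg)
    have nzy: "y \<noteq> \<zero>" using y sub by (auto simp: carrier_mgrp)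
    have "\<not> vle M ((x \<ominus> \<one>) \<otimes> y) (\<one> \<otimes> y)"
      using x vle_mult_cancel[OF nzy, of "x \<ominus> \<one>" \<one>] unfolding mem by blast
    then have "\<not> vle M ((x \<ominus> \<one>) \<otimes> y) \<one>"
      using veq1[OF y] vle_trans unfolding veq_def by auto
    moreover have "\<not> vle M (y \<ominus> \<one>) \<one>"
      using y mem by simp
    ultimately have "\<not> vle M (x \<otimes> y \<ominus> \<one>) \<one>"
      unfolding eq by (metis vle_add vle_linear vle_trans)
    then show "x \<otimes>\<^bsub>mgrp M\<^esub> y \<in> one_units M"
      unfolding mult_mgrp mem .
  qed
qed

lemma one_units_normal: "one_units M \<lhd> mgrp M"
  by (rule comm_group.subgroup_imp_normal[OF mgrp_comm_group one_units_subgroup])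

lemma RV_group: "group (RV M)"
  unfolding RV_def by (rule normal.factorgroup_is_group[OF one_units_normal])

lemma carrier_RV: "carrier (RV M) = rv M ` {x. x \<noteq> \<zero>}"
  unfolding RV_def carrier_FactGroup carrier_mgrp rv_def by simp

lemma carrier_Gam: "carrier (Gam M) = val M ` {x. x \<noteq> \<zero>}"
  unfolding Gam_def carrier_FactGroup carrier_mgrp val_def by simp

lemma rv_mult: "x \<noteq> \<zero> \<Longrightarrow> y \<noteq> \<zero> \<Longrightarrow> rv M x \<otimes>\<^bsub>RV M\<^esub> rv M y = rv M (x \<otimes> y)"
  unfolding RV_def mult_FactGroup rv_def mult_mgrp[symmetric]
  by (rule normal.rcos_sum[OF one_units_normal]) (auto simp: carrier_mgrp)

lemma rv_closed [simp]: "x \<noteq> \<zero> \<Longrightarrow> rv M x \<in> carrier (RV M)"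
  by (simp add: carrier_RV)

lemma rv_self: "x \<noteq> \<zero> \<Longrightarrow> x \<in> rv M x"
  by (simp add: mem_rv_iff a_minus_def r_neg)

lemma rv_eq_iff: "x \<noteq> \<zero> \<Longrightarrow> y \<noteq> \<zero> \<Longrightarrow> rv M y = rv M x \<longleftrightarrow> \<not> vle M (y \<ominus> x) x"
proof -
  assume x: "x \<noteq> \<zero>" and y: "y \<noteq> \<zero>"
  interpret G: comm_group "mgrp M" by (rule mgrp_comm_group)
  have "rv M y = rv M x \<longleftrightarrow> y \<in> rv M x"
    using G.repr_independence[OF _ _ one_units_subgroup, of y x] rv_self[OF y] x
    by (auto simp: rv_def carrier_mgrp)
  then show ?thesis using mem_rv_iff[OF x] by simp
qed

text \<open>The valuation is constant on an RV class, so \<open>the_elem\<close> in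
  \<open>val_RV\<close> is applied to a singleton.\<close>

lemma val_RV_rv: "x \<noteq> \<zero> \<Longrightarrow> val_RV M (rv M x) = val M x"
proof -
  assume x: "x \<noteq> \<zero>"
  have "val M y = val M x" if "y \<in> rv M x" for y
    using mem_rv_imp_veq[OF x that] veq_zero_iff[of y x] x val_eq_iff by blast
  then have "val M ` rv M x = {val M x}"
    using rv_self[OF x] by blast
  then show ?thesis by (simp add: val_RV_def)
qed

lemma rv_mem_RV_fib: "x \<noteq> \<zero> \<Longrightarrow> c \<noteq> \<zero> \<Longrightarrow> rv M x \<in> RV_fib M (val M c) \<longleftrightarrow> veq M x c"
  by (simp add: RV_fib_def val_RV_rv val_eq_iff)

end

section \<open>Definable sets with finite fibres over the value group\<close>

context acvf
begin

section \<open>Infinitely many RV classes over each value\<close>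

lemma rv_pow: "x \<noteq> \<zero> \<Longrightarrow> rv M x [^]\<^bsub>RV M\<^esub> (n :: nat) = rv M (x [^] n)"
proof (induction n)
  case 0
  have "one_units M = rv M \<one>"
    unfolding rv_def r_coset_def mult_mgrp by simp
  then show ?case by (simp add: RV_def)
next
  case (Suc n)
  have "x [^] n \<noteq> \<zero>"
    using Suc.prems by (induction n) (auto simp: integral_iff)
  with Suc show ?case by (simp add: rv_mult)
qed

text \<open>Algebraic closedness enters here: it supplies the root that keeps the residue field from
  being finite.\<close>

lemma exists_root_trinomial:
  fixes n :: nat
  assumes "n > 0"
  shows "\<exists>z. z [^] n \<otimes> z = z \<oplus> \<one>"
proof -
  \<comment> \<open>The coefficients of X^(n+1) - X - 1, highest degree first. As n > 0, exactly n -
    1 zeros separate the leading coefficient from that of X.\<close>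
  define p where "p = \<one> # replicate (n - 1) \<zero> @ [\<ominus> \<one>, \<ominus> \<one>]"
  have p: "p \<in> carrier (poly_ring R)"
    unfolding sym[OF univ_poly_carrier] polynomial_def by (auto simp: p_def)
  have "size (roots p) = degree p"
    using algebraically_closed.roots_over_carrier[OF algebraically_closed p]
    by (simp add: splitted_def)
  then have "size (roots p) \<noteq> 0"
    by (simp add: p_def)
  then obtain z where "z \<in># roots p"
    by (metis multiset_nonemptyE size_empty)
  then have "eval p z = \<zero>"
    using roots_mem_iff_is_root[OF p] by (simp add: is_root_def)
  moreover have "eval p z = z [^] Suc n \<oplus> (\<ominus> z \<oplus> \<ominus> \<one>)"
    using assms eval_replicate[of "[\<ominus> \<one>, \<ominus> \<one>]" z "n - 1"] by (simp add: p_def l_minus)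
  ultimately have "z [^] Suc n = \<ominus> (\<ominus> z \<oplus> \<ominus> \<one>)"
    using minus_equality[of "z [^] Suc n" "\<ominus> z \<oplus> \<ominus> \<one>"] by simp
  then have "z [^] n \<otimes> z = z \<oplus> \<one>"
    by (simp add: minus_add)
  then show ?thesis ..
qed

text \<open>If the residue field had \<open>n + 1\<close> elements, then every integral \<open>z\<close> would satisfy
  \<open>z\<^sup>n\<^sup>+\<^sup>1 \<equiv> z\<close> modulo the maximal ideal, contrary to the existence of a root of
  \<open>z\<^sup>n\<^sup>+\<^sup>1 = z + 1\<close>.\<close>

lemma infinite_rv_units: "infinite (rv M ` {y. veq M y \<one>})" (is "infinite ?K")
proof
  assume fin: "finite ?K"
  interpret RV: group "RV M" by (rule RV_group)
  have nz: "y \<noteq> \<zero>" if "veq M y \<one>" for y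
    using veq_zero_iff[OF that] by simp
  have sub: "subgroup ?K (RV M)"
  proof (rule RV.subgroupI)
    show "?K \<subseteq> carrier (RV M)" using nz by auto
    show "?K \<noteq> {}" using veq_refl by blast
    fix a assume "a \<in> ?K"
    then obtain x where x: "veq M x \<one>" "a = rv M x" by blast
    then have xinv: "veq M (inv x) \<one>"
      using veq_mult[of x \<one> "inv x" "inv x"] nz veq_sym by fastforce
    have "rv M (inv x) \<otimes>\<^bsub>RV M\<^esub> a = \<one>\<^bsub>RV M\<^esub>"
      using x nz rv_mult[of "inv x" x] rv_pow[of \<one> 0] by simp
    then have "inv\<^bsub>RV M\<^esub> a = rv M (inv x)"
      using x nz xinv by (intro RV.inv_equality) auto
    with xinv show "inv\<^bsub>RV M\<^esub> a \<in> ?K" by blast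
    fix b assume "b \<in> ?K"
    then obtain y where y: "veq M y \<one>" "b = rv M y" by blast
    then have "a \<otimes>\<^bsub>RV M\<^esub> b = rv M (x \<otimes> y)"
      using x nz rv_mult by simp
    moreover have "veq M (x \<otimes> y) \<one>"
      using veq_mult[OF x(1) y(1)] by simp
    ultimately show "a \<otimes>\<^bsub>RV M\<^esub> b \<in> ?K" by blast
  qed
  define n where "n = card ?K"
  have n: "n > 0"
    unfolding n_def using fin veq_refl by (subst card_gt_0_iff) blast
  \<comment> \<open>Lagrange in the supposedly finite group \<open>?K\<close>: its order
    \<open>n\<close> is an exponent, so x^n - 1 lies in the maximal ideal.\<close>
  have pow: "\<not> vle M (x [^] n \<ominus> \<one>) \<one>" if x: "veq M x \<one>" for x
  proof -
    interpret K: group "RV M\<lparr>carrier := ?K\<rparr>"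
      by (rule RV.subgroup_imp_group[OF sub])
    have "rv M x [^]\<^bsub>RV M\<lparr>carrier := ?K\<rparr>\<^esub> order (RV M\<lparr>carrier := ?K\<rparr>) = \<one>\<^bsub>RV M\<^esub>"
      using K.pow_order_eq_1[of "rv M x"] x by simp
    then have "rv M x [^]\<^bsub>RV M\<^esub> n = \<one>\<^bsub>RV M\<^esub>"
      using RV.nat_pow_consistent[of "rv M x" n ?K] by (simp add: order_def n_def)
    then have "rv M (x [^] n) = rv M \<one>"
      using x nz rv_pow[of x n] rv_pow[of \<one> 0] by simp
    moreover have "x [^] n \<noteq> \<zero>"
      using nz[OF x] by (induction n) (auto simp: integral_iff)
    ultimately show ?thesis
      using rv_eq_iff[of \<one> "x [^] n"] by simp
  qed
  obtain z where z: "z [^] n \<otimes> z = z \<oplus> \<one>"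
    using exists_root_trinomial[OF n] by blast
  have eq: "(z [^] n \<ominus> \<one>) \<otimes> z = \<one>"
    using z by (simp add: a_minus_def l_distr l_minus) (simp add: a_comm[of _ "\<ominus> z"] r_neg1)
  \<comment> \<open>If v(z) < 0, then z + 1 = z^(n+1) has value at most 2v(z), while v(z + 1) \<ge>
    v(z); this forces v(z) \<ge> 0.\<close>
  have int: "vle M \<one> z"
  proof (rule ccontr)
    assume neg: "\<not> vle M \<one> z"
    then have z1: "vle M z \<one>" and z0: "z \<noteq> \<zero>"
      using vle_linear vle_zero by blast+
    have "vle M (z [^] Suc k) z" for k
    proof (induction k)
      case (Suc k)
      from vle_mult[OF Suc, of z] have "vle M (z [^] Suc (Suc k)) (z \<otimes> z)" by simp
      moreover have "vle M (z \<otimes> z) z"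
        using vle_mult[OF z1, of z] by simp
      ultimately show ?case using vle_trans by blast
    qed simp
    from vle_mult[OF this[of "n - 1"], of z] have "vle M (z \<oplus> \<one>) (z \<otimes> z)"
      using n z by simp
    moreover have "vle M z (z \<oplus> \<one>)"
      using z1 by (intro vle_add) auto
    ultimately have "vle M (\<one> \<otimes> z) (z \<otimes> z)"
      using vle_trans by simp
    then show False using neg vle_mult_cancel[OF z0] by blast
  qed
  show False
  \<comment> \<open>Both cases contradict (z^n - 1)z = 1. If \<open>z\<close> is a unit, the first
    factor has positive value by \<open>pow\<close>; otherwise v(z) > 0 and the first factor is
    integral.\<close>
  proof (cases "vle M z \<one>")
    case True
    then have unit: "veq M z \<one>" using int by (simp add: veq_def)
    have "\<not> vle M ((z [^] n \<ominus> \<one>) \<otimes> z) (\<one> \<otimes> z)"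
      using pow[OF unit] vle_mult_cancel[OF nz[OF unit]] by blast
    then show False using eq int by simp
  next
    case False
    have "vle M \<one> (z [^] k)" for k :: nat
    proof (induction k)
      case (Suc k)
      from vle_mult[OF this, of z] show ?case using int vle_trans by simp
    qed simp
    then have "vle M \<one> (z [^] n \<ominus> \<one>)"
      by (intro vle_minus) auto
    from vle_mult[OF this, of z] show False using eq False by simp
  qed
qed

text \<open>Dividing by the class of \<open>c\<close> carries the classes over v(c) onto those over
  v(1).\<close>

lemma infinite_rv_fibre:
  assumes "c \<noteq> \<zero>"
  shows "infinite (rv M ` {y. veq M y c})"
proof
  assume "finite (rv M ` {y. veq M y c})"
  moreover have "rv M ` {y. veq M y \<one>} \<subseteq>
      (\<lambda>u. u \<otimes>\<^bsub>RV M\<^esub> rv M (inv c)) ` (rv M ` {y. veq M y c})"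
  proof
    fix a assume "a \<in> rv M ` {y. veq M y \<one>}"
    then obtain y where y: "veq M y \<one>" "a = rv M y" by blast
    then have "veq M (y \<otimes> c) c"
      using veq_mult[of y \<one> c c] by simp
    moreover have "a = rv M (y \<otimes> c) \<otimes>\<^bsub>RV M\<^esub> rv M (inv c)"
      using y assms veq_zero_iff[OF y(1)] by (simp add: rv_mult integral_iff m_assoc)
    ultimately show "a \<in> (\<lambda>u. u \<otimes>\<^bsub>RV M\<^esub> rv M (inv c)) ` (rv M ` {y. veq M y c})"
      by blast
  qed
  ultimately show False
    using infinite_rv_units finite_surj by blast
qed

section \<open>C-minimality, finite images in the value group, and translates\<close>

text \<open>A ball or point not containing 0 lies in a single fibre of the valuation, and a ball around 0
  is a union of fibres.\<close>

lemma bool_combs_union_of_fibres: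
  assumes "S \<in> bool_combs (balls_and_points M)"
  shows "\<exists>F. finite F \<and> (\<forall>x y. veq M x y \<longrightarrow> (\<forall>c\<in>F. \<not> veq M x c) \<longrightarrow> (x \<in> S \<longleftrightarrow> y \<in> S))"
  using assms
proof induction
  case (base B)
  \<comment> \<open>The centre of the ball, or the point itself, serves as \<open>c\<close>; for
    balls this is \<open>veq_minus_cong\<close>.\<close>
  have "\<exists>c. \<forall>x y. veq M x y \<longrightarrow> \<not> veq M x c \<longrightarrow> (x \<in> B \<longleftrightarrow> y \<in> B)"
  proof -
    consider c r where "B = open_ball M c r" | c r where "B = closed_ball M c r" | c where "B = {c}"
      using base unfolding balls_and_points_def by blast
    then show ?thesis
    proof cases
      case (1 c r)
      show ?thesis
        using veq_minus_cong[of _ _ c] vle_trans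
        unfolding 1 open_ball_def R_def[symmetric] veq_def by (intro exI[of _ c]) blast
    next
      case (2 c r)
      show ?thesis
        using veq_minus_cong[of _ _ c] vle_trans
        unfolding 2 closed_ball_def R_def[symmetric] veq_def by (intro exI[of _ c]) blast
    next
      case (3 c)
      then show ?thesis by (intro exI[of _ c]) auto
    qed
  qed
  then obtain c where "\<forall>x y. veq M x y \<longrightarrow> \<not> veq M x c \<longrightarrow> (x \<in> B \<longleftrightarrow> y \<in> B)" ..
  then show ?case by (intro exI[of _ "{c}"]) auto
next
  case (compl B)
  then show ?case by auto
next
  case (union B C)
  then obtain F G where "finite F" "finite G"
    "\<forall>x y. veq M x y \<longrightarrow> (\<forall>c\<in>F. \<not> veq M x c) \<longrightarrow> (x \<in> B \<longleftrightarrow> y \<in> B)"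
    "\<forall>x y. veq M x y \<longrightarrow> (\<forall>c\<in>G. \<not> veq M x c) \<longrightarrow> (x \<in> C \<longleftrightarrow> y \<in> C)"
    by blast
  then show ?case by (intro exI[of _ "F \<union> G"] conjI allI impI) (simp, blast)
qed

text \<open>Away from the finitely many exceptional values, a fibre of v that meets \<open>P\<close>
  lies inside it. Such a fibre has infinitely many RV classes, against \<open>fin\<close>, so every
  value of \<open>P\<close> is exceptional.\<close>

lemma finite_val_image:
  assumes "C_minimal L M" and "definable_rel L M (\<lambda>s. P (s 0))"
    and nz: "\<And>x. P x \<Longrightarrow> x \<noteq> \<zero>"
    and fin: "\<And>x. P x \<Longrightarrow> finite (rv M ` {y. P y \<and> veq M y x})"
  shows "finite (val M ` Collect P)"
proof -
  have "Collect P \<in> bool_combs (balls_and_points M)"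
    using assms(1) definable_rel_imp_definable[OF assms(2)] by (simp add: C_minimal_def)
  then obtain F where F: "finite F"
    "\<And>x y. veq M x y \<Longrightarrow> (\<And>c. c \<in> F \<Longrightarrow> \<not> veq M x c) \<Longrightarrow> P x \<longleftrightarrow> P y"
    using bool_combs_union_of_fibres by (metis mem_Collect_eq)
  have "val M x \<in> val M ` F" if x: "P x" for x
  proof (rule ccontr)
    assume x': "val M x \<notin> val M ` F"
    have "\<not> veq M x c" if "c \<in> F" for c
      using x' that nz[OF x] val_eq_iff[of x c] veq_zero_iff[of x c] by auto
    then have "{y. P y \<and> veq M y x} = {y. veq M y x}"
      using F(2) x veq_sym by blast
    then show False
      using fin[OF x] infinite_rv_fibre[OF nz[OF x]] by simp
  qed
  then have "val M ` Collect P \<subseteq> val M ` F" by blast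
  then show ?thesis using F(1) finite_surj by blast
qed

text \<open>The one-variable result is applied twice: to the second coordinates over a fixed first
  value, then to the first projection. Finiteness of the sections is what bounds the RV classes in
  the projection.\<close>

lemma finite_val_image2:
  assumes L: "expands_vf_lang L" and C: "C_minimal L M"
    and E: "definable_rel L M (\<lambda>s. E (s 0) (s 1))"
    and nz: "\<And>x y. E x y \<Longrightarrow> x \<noteq> \<zero> \<and> y \<noteq> \<zero>"
    and fin: "\<And>x y. E x y \<Longrightarrow>
      finite ((\<lambda>(x', y'). (rv M x', rv M y')) ` {(x', y'). E x' y' \<and> veq M x' x \<and> veq M y' y})"
  shows "finite ((\<lambda>(x, y). (val M x, val M y)) ` {(x, y). E x y})"
proof -
  \<comment> \<open>The section is taken over the whole fibre of v through \<open>x\<close>, so that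
    it depends only on v(x) and representatives of the first values suffice at the end.\<close>
  define V where "V x = val M ` {y. \<exists>x'. veq M x' x \<and> E x' y}" for x
  have V: "finite (V x)" for x
    unfolding V_def
  proof (rule finite_val_image[OF C])
    have "definable_rel L M (\<lambda>s. \<exists>x'. veq M x' x \<and> E x' (s 1))"
      using definable_rel_Ex[OF definable_rel_And[OF definable_rel_veq[OF L, of _ 0 x] E], of 0]
      by simp
    from definable_rel_subst_var[OF this, of 1 0]
    show "definable_rel L M (\<lambda>s. \<exists>x'. veq M x' x \<and> E x' (s 0))" by simp
  next
    fix y assume y: "\<exists>x'. veq M x' x \<and> E x' y"
    then show "y \<noteq> \<zero>" using nz by blast
    obtain x' where x': "veq M x' x" "E x' y" using y by blast
    let ?A = "{(x'', y'). E x'' y' \<and> veq M x'' x' \<and> veq M y' y}"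
    have "rv M ` {y'. (\<exists>x'. veq M x' x \<and> E x' y') \<and> veq M y' y} \<subseteq>
        snd ` (\<lambda>(x', y'). (rv M x', rv M y')) ` ?A"
    proof safe
      fix y' x'' assume "veq M x'' x" "E x'' y'" "veq M y' y"
      then have "(x'', y') \<in> ?A" using x' veq_trans veq_sym by blast
      then show "rv M y' \<in> snd ` (\<lambda>(x', y'). (rv M x', rv M y')) ` ?A"
        by (force simp: image_iff)
    qed
    then show "finite (rv M ` {y'. (\<exists>x'. veq M x' x \<and> E x' y') \<and> veq M y' y})"
      using fin[OF x'(2)] finite_subset by blast
  qed
  define U where "U = val M ` {x. \<exists>y. E x y}"
  have "finite U"
    unfolding U_def
  proof (rule finite_val_image[OF C])
    show "definable_rel L M (\<lambda>s. \<exists>y. E (s 0) y)"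
      using definable_rel_Ex[OF E, of 1] by simp
  next
    fix x assume "\<exists>y. E x y"
    then show "x \<noteq> \<zero>" using nz by blast
    define A where "A y = {(x', y'). E x' y' \<and> veq M x' x \<and> veq M y' y}" for y
    \<comment> \<open>The pair (x, y) need not satisfy \<open>E\<close>, as \<open>fin\<close>
      demands; any member of a nonempty \<open>A y\<close> can serve as base point instead.\<close>
    have finA: "finite ((\<lambda>(x', y'). (rv M x', rv M y')) ` A y)" for y
    proof (cases "A y = {}")
      case False
      then obtain x1 y1 where 1: "E x1 y1" "veq M x1 x" "veq M y1 y"
        by (auto simp: A_def)
      then have "A y = {(x', y'). E x' y' \<and> veq M x' x1 \<and> veq M y' y1}"
        unfolding A_def using veq_trans veq_sym by blast
      then show ?thesis using fin[OF 1(1)] by simp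
    qed simp
    \<comment> \<open>Representatives of the values in \<open>V x\<close>, taken from the section
      itself so that they are nonzero.\<close>
    obtain Y where Y: "finite Y" "V x = val M ` Y"
      "Y \<subseteq> {y. \<exists>x'. veq M x' x \<and> E x' y}"
      using finite_subset_image[OF V[of x], of "val M" "{y. \<exists>x'. veq M x' x \<and> E x' y}"]
      by (auto simp: V_def)
    have "rv M ` {x'. (\<exists>y. E x' y) \<and> veq M x' x} \<subseteq>
        (\<Union>y\<in>Y. fst ` (\<lambda>(x', y'). (rv M x', rv M y')) ` A y)"
    proof safe
      fix x' y' assume x': "E x' y'" "veq M x' x"
      then have "val M y' \<in> V x" by (auto simp: V_def)
      then obtain y where y: "y \<in> Y" "val M y' = val M y" using Y(2) by auto
      then have "veq M y' y"
        using val_eq_iff[of y' y] nz x'(1) Y(3) by blast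
      then have "(x', y') \<in> A y" using x' by (simp add: A_def)
      then have "rv M x' \<in> fst ` (\<lambda>(x', y'). (rv M x', rv M y')) ` A y"
        by (force simp: image_iff)
      with y(1) show "rv M x' \<in> (\<Union>y\<in>Y. fst ` (\<lambda>(x', y'). (rv M x', rv M y')) ` A y)"
        by blast
    qed
    moreover have "finite (\<Union>y\<in>Y. fst ` (\<lambda>(x', y'). (rv M x', rv M y')) ` A y)"
      using Y(1) finA by blast
    ultimately show "finite (rv M ` {x'. (\<exists>y. E x' y) \<and> veq M x' x})"
      using finite_subset by blast
  qed
  then obtain W where W: "finite W" "U = val M ` W" "W \<subseteq> {x. \<exists>y. E x y}"
    using finite_subset_image[of U "val M" "{x. \<exists>y. E x y}"] by (auto simp: U_def)
  have "(\<lambda>(x, y). (val M x, val M y)) ` {(x, y). E x y} \<subseteq> U \<times> (\<Union>x\<in>W. V x)"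
  proof safe
    fix x y assume xy: "E x y"
    then show "val M x \<in> U" by (auto simp: U_def)
    then obtain x' where x': "x' \<in> W" "val M x = val M x'" using W(2) by auto
    then have "veq M x x'"
      using val_eq_iff[of x x'] nz xy W(3) by blast
    then have "val M y \<in> V x'" using xy by (auto simp: V_def)
    with x'(1) show "val M y \<in> (\<Union>x\<in>W. V x)" by blast
  qed
  then show ?thesis
    using \<open>finite U\<close> W(1) V finite_subset by (meson finite_SigmaI finite_UN_I)
qed

text \<open>If (rv x, rv y) translates the fragment onto the part of \<open>D\<close> over (a', b'),
  then a' = v(xc) and b' = v(yd). So it is enough to bound the values of the translating pairs, to
  which \<open>finite_val_image2\<close> applies.\<close>

lemma finite_translates:
  assumes L: "expands_vf_lang L" and C: "C_minimal L M"
    and D: "definable_RV2 L M D" and Y: "definable_RV2 L M Y" and "Y \<noteq> {}"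
    and "a \<in> carrier (Gam M)" and "b \<in> carrier (Gam M)"
    and Yab: "Y \<subseteq> RV_fib M a \<times> RV_fib M b" and stab: "finite (Stab M Y)"
  shows "finite {(a, b). \<exists>u\<in>carrier (RV M). \<exists>w\<in>carrier (RV M).
           D \<inter> (RV_fib M a \<times> RV_fib M b) = (u, w) <#\<^bsub>RV2 M\<^esub> Y}"
proof -
  interpret RV2: group "RV2 M"
    unfolding RV2_def by (rule DirProd_group[OF RV_group RV_group])
  obtain c d where c: "c \<noteq> \<zero>" "a = val M c" and d: "d \<noteq> \<zero>" "b = val M d"
    using assms(6,7) by (auto simp: carrier_Gam)
  have Ycar: "Y \<subseteq> carrier (RV2 M)"
    using Y by (simp add: definable_RV2_def)
  have mem_Y: "\<exists>x y. u = (rv M x, rv M y) \<and> veq M x c \<and> veq M y d \<and> x \<noteq> \<zero> \<and> y \<noteq> \<zero>"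
    if u: "u \<in> Y" for u
  proof -
    have "fst u \<in> RV_fib M a" "snd u \<in> RV_fib M b"
      using u Yab by auto
    moreover from this obtain x y where "fst u = rv M x" "snd u = rv M y" "x \<noteq> \<zero>" "y \<noteq> \<zero>"
      by (auto simp: RV_fib_def carrier_RV)
    ultimately show ?thesis
      using c d by (metis rv_mem_RV_fib prod.collapse)
  qed
  have translate: "(rv M x, rv M y) <#\<^bsub>RV2 M\<^esub> Y = {(rv M (x \<otimes> x'), rv M (y \<otimes> y')) |x' y'.
      veq M x' c \<and> veq M y' d \<and> (rv M x', rv M y') \<in> Y}"
    if "x \<noteq> \<zero>" "y \<noteq> \<zero>" for x y
  proof (intro equalityI subsetI)
    fix p assume "p \<in> (rv M x, rv M y) <#\<^bsub>RV2 M\<^esub> Y"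
    then obtain u where u: "u \<in> Y" "p = (rv M x, rv M y) \<otimes>\<^bsub>RV2 M\<^esub> u"
      by (auto simp: l_coset_def)
    obtain x' y' where "u = (rv M x', rv M y')" "veq M x' c" "veq M y' d" "x' \<noteq> \<zero>" "y' \<noteq> \<zero>"
      using mem_Y[OF u(1)] by blast
    moreover from this have "p = (rv M (x \<otimes> x'), rv M (y \<otimes> y'))"
      using u(2) that by (simp add: RV2_def rv_mult)
    ultimately show "p \<in> {(rv M (x \<otimes> x'), rv M (y \<otimes> y')) |x' y'.
      veq M x' c \<and> veq M y' d \<and> (rv M x', rv M y') \<in> Y}"
      using u(1) by blast
  next
    fix p assume "p \<in> {(rv M (x \<otimes> x'), rv M (y \<otimes> y')) |x' y'.
      veq M x' c \<and> veq M y' d \<and> (rv M x', rv M y') \<in> Y}"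
    then obtain x' y' where p: "p = (rv M (x \<otimes> x'), rv M (y \<otimes> y'))"
      "veq M x' c" "veq M y' d" "(rv M x', rv M y') \<in> Y" by blast
    then have "p = (rv M x, rv M y) \<otimes>\<^bsub>RV2 M\<^esub> (rv M x', rv M y')"
      using that c d veq_zero_iff[of x' c] veq_zero_iff[of y' d] by (simp add: RV2_def rv_mult)
    with p(4) show "p \<in> (rv M x, rv M y) <#\<^bsub>RV2 M\<^esub> Y"
      unfolding l_coset_def by blast
  qed
  have mem_translate: "(rv M (x \<otimes> x'), rv M (y \<otimes> y')) \<in> (rv M x, rv M y) <#\<^bsub>RV2 M\<^esub> Y \<longleftrightarrow>
      (rv M x', rv M y') \<in> Y"
    if "x \<noteq> \<zero>" "y \<noteq> \<zero>" "x' \<noteq> \<zero>" "y' \<noteq> \<zero>" for x y x' y'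
  proof -
    have "(rv M (x \<otimes> x'), rv M (y \<otimes> y')) = (rv M x, rv M y) \<otimes>\<^bsub>RV2 M\<^esub> (rv M x', rv M y')"
      using that by (simp add: RV2_def rv_mult)
    moreover have "(rv M x, rv M y) \<in> carrier (RV2 M)" "(rv M x', rv M y') \<in> carrier (RV2 M)"
      using that by (simp_all add: RV2_def)
    moreover have "g \<otimes>\<^bsub>RV2 M\<^esub> h \<in> g <#\<^bsub>RV2 M\<^esub> Y \<longleftrightarrow> h \<in> Y"
      if "g \<in> carrier (RV2 M)" "h \<in> carrier (RV2 M)" for g h
    proof -
      have "g \<otimes>\<^bsub>RV2 M\<^esub> h = g \<otimes>\<^bsub>RV2 M\<^esub> k \<longleftrightarrow> h = k" if "k \<in> Y" for k
        using RV2.Units_l_cancel[of g h k] RV2.Units_eq that Ycar \<open>g \<in> _\<close> \<open>h \<in> _\<close> by blast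
      then show ?thesis unfolding l_coset_def by auto
    qed
    ultimately show ?thesis by simp
  qed
  define hom where
    "hom S = {[x, y] |x y. x \<noteq> \<zero> \<and> y \<noteq> \<zero> \<and> (rv M x, rv M y) \<in> S}" for S
  \<comment> \<open>The equivalence ranges over the full product of fibres containing
    \<open>Y\<close>, so it also excludes points of \<open>D\<close> outside the translate.\<close>
  define E where "E x y \<longleftrightarrow> x \<noteq> \<zero> \<and> y \<noteq> \<zero> \<and> (\<forall>x' y'. veq M x' c \<longrightarrow> veq M y' d \<longrightarrow>
      ([x \<otimes> x', y \<otimes> y'] \<in> hom D \<longleftrightarrow> [x', y'] \<in> hom Y))" for x y
  have E_nz: "E x y \<Longrightarrow> x \<noteq> \<zero> \<and> y \<noteq> \<zero>" for x y
    by (simp add: E_def)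
  have E_iff: "(rv M (x \<otimes> x'), rv M (y \<otimes> y')) \<in> D \<longleftrightarrow> (rv M x', rv M y') \<in> Y"
    if "E x y" "veq M x' c" "veq M y' d" for x y x' y'
    using that c d veq_zero_iff[of x' c] veq_zero_iff[of y' d]
    by (auto simp: E_def hom_def integral_iff)
  have "finite ((\<lambda>(x, y). (val M x, val M y)) ` {(x, y). E x y})"
  proof (rule finite_val_image2[OF L C])
    have "definable L M 2 (hom D)" "definable L M 2 (hom Y)"
      using D Y unfolding definable_RV2_def hom_def R_def by simp_all
    then show "definable_rel L M (\<lambda>s. E (s 0) (s 1))"
      unfolding E_def unfolding R_def by (rule definable_rel_translate[OF L])
  next
    show "x \<noteq> \<zero> \<and> y \<noteq> \<zero>" if "E x y" for x y
      using E_nz that .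
  next
    fix x y assume E: "E x y"
    have nz: "x \<noteq> \<zero>" "y \<noteq> \<zero>" using E_nz[OF E] by auto
    let ?g = "(rv M x, rv M y)"
    \<comment> \<open>Two solutions with the same values differ by an element of the
      stabilizer.\<close>
    have "(rv M x', rv M y') \<in> (\<lambda>g. g \<otimes>\<^bsub>RV2 M\<^esub> ?g) ` Stab M Y"
      if E': "E x' y'" and xy': "veq M x' x" "veq M y' y" for x' y'
    proof -
      define p where "p = x' \<otimes> inv x"
      define q where "q = y' \<otimes> inv y"
      have nz': "x' \<noteq> \<zero>" "y' \<noteq> \<zero>" using E_nz[OF E'] by auto
      have pq: "p \<noteq> \<zero>" "q \<noteq> \<zero>" "x \<otimes> p = x'" "y \<otimes> q = y'"
        using nz nz' by (simp_all add: p_def q_def integral_iff m_lcomm)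
      have pq1: "veq M p \<one>" "veq M q \<one>"
        using veq_mult[OF xy'(1), of "inv x" "inv x"] veq_mult[OF xy'(2), of "inv y" "inv y"] nz
        by (simp_all add: p_def q_def)
      \<comment> \<open>Multiplication by (p, q) preserves values. \<open>E x y\<close> at (px'',
        qy'') and \<open>E x' y'\<close> at (x'', y'') both speak of the class of (x'x'', y'y'') in
        \<open>D\<close>.\<close>
      have "(rv M (p \<otimes> x''), rv M (q \<otimes> y'')) \<in> Y \<longleftrightarrow> (rv M x'', rv M y'') \<in> Y"
        if xy: "veq M x'' c" "veq M y'' d" for x'' y''
      proof -
        have "veq M (p \<otimes> x'') c" "veq M (q \<otimes> y'') d"
          using veq_mult[OF pq1(1) xy(1)] veq_mult[OF pq1(2) xy(2)] by simp_all
        then have "(rv M (x \<otimes> (p \<otimes> x'')), rv M (y \<otimes> (q \<otimes> y''))) \<in> D \<longleftrightarrow>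
            (rv M (p \<otimes> x''), rv M (q \<otimes> y'')) \<in> Y"
          by (rule E_iff[OF E])
        moreover have "x \<otimes> (p \<otimes> x'') = x' \<otimes> x''" "y \<otimes> (q \<otimes> y'') = y' \<otimes> y''"
          using pq(3,4) by (simp_all flip: m_assoc)
        ultimately show ?thesis
          using E_iff[OF E' xy] by simp
      qed
      note inv_Y = this
      have "(rv M p, rv M q) <#\<^bsub>RV2 M\<^esub> Y = Y"
      proof (intro equalityI subsetI)
        fix u assume "u \<in> (rv M p, rv M q) <#\<^bsub>RV2 M\<^esub> Y"
        then show "u \<in> Y" using inv_Y unfolding translate[OF pq(1,2)] by blast
      next
        fix u assume u: "u \<in> Y"
        then obtain x1 y1 where 1: "u = (rv M x1, rv M y1)" "veq M x1 c" "veq M y1 d"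
          using mem_Y by blast
        \<comment> \<open>Dividing by (p, q) stays in the same fibres, and \<open>inv_Y\<close> puts
          the quotient into \<open>Y\<close>.\<close>
        define x2 where "x2 = inv p \<otimes> x1"
        define y2 where "y2 = inv q \<otimes> y1"
        have 2: "p \<otimes> x2 = x1" "q \<otimes> y2 = y1"
          using pq(1,2) by (simp_all add: x2_def y2_def flip: m_assoc)
        have "veq M x1 x2" "veq M y1 y2"
          using veq_mult[OF pq1(1) veq_refl[of x2]] veq_mult[OF pq1(2) veq_refl[of y2]] 2 by simp_all
        then have "veq M x2 c" "veq M y2 d"
          using veq_trans[OF veq_sym 1(2)] veq_trans[OF veq_sym 1(3)] by simp_all
        moreover from this have "(rv M x2, rv M y2) \<in> Y"
          using inv_Y[of x2 y2] u 1(1) 2 by simp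
        ultimately show "u \<in> (rv M p, rv M q) <#\<^bsub>RV2 M\<^esub> Y"
          unfolding translate[OF pq(1,2)] using 1(1) 2 by blast
      qed
      then have "(rv M p, rv M q) \<in> Stab M Y"
        using pq(1,2) by (simp add: Stab_def RV2_def)
      moreover have "(rv M x', rv M y') = (rv M p, rv M q) \<otimes>\<^bsub>RV2 M\<^esub> ?g"
        using pq nz by (simp add: RV2_def rv_mult m_comm)
      ultimately show ?thesis by blast
    qed
    then have "(\<lambda>(x', y'). (rv M x', rv M y')) ` {(x', y'). E x' y' \<and> veq M x' x \<and> veq M y' y}
        \<subseteq> (\<lambda>g. g \<otimes>\<^bsub>RV2 M\<^esub> ?g) ` Stab M Y"
      by auto
    then show "finite ((\<lambda>(x', y'). (rv M x', rv M y')) `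
        {(x', y'). E x' y' \<and> veq M x' x \<and> veq M y' y})"
      using stab finite_surj by blast
  qed
  then obtain W where W: "finite W" "W \<subseteq> {(x, y). E x y}"
    "(\<lambda>(x, y). (val M x, val M y)) ` {(x, y). E x y} = (\<lambda>(x, y). (val M x, val M y)) ` W"
    by (auto dest!: finite_subset_image[OF _ subset_refl])
  have "(a', b') \<in> (\<lambda>(x, y). (val M (x \<otimes> c), val M (y \<otimes> d))) ` W"
    if uw: "u \<in> carrier (RV M)" "w \<in> carrier (RV M)"
      "D \<inter> (RV_fib M a' \<times> RV_fib M b') = (u, w) <#\<^bsub>RV2 M\<^esub> Y" for a' b' u w
  proof -
    obtain x y where x: "x \<noteq> \<zero>" "u = rv M x" and y: "y \<noteq> \<zero>" "w = rv M y"
      using uw(1,2) by (auto simp: carrier_RV)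
    have val: "val M (x \<otimes> x') = val M (x \<otimes> c)" "val M (y \<otimes> y') = val M (y \<otimes> d)"
      "x \<otimes> x' \<noteq> \<zero>" "y \<otimes> y' \<noteq> \<zero>" "x' \<noteq> \<zero>" "y' \<noteq> \<zero>"
      if "veq M x' c" "veq M y' d" for x' y'
      using that x y c d veq_zero_iff[of x' c] veq_zero_iff[of y' d]
      by (simp_all add: val_eq_iff integral_iff veq_mult)
    \<comment> \<open>A point of \<open>Y\<close> is needed to read off a' and b': its translate
      lies in the product of their fibres.\<close>
    obtain x1 y1 where 1: "(rv M x1, rv M y1) \<in> Y" "veq M x1 c" "veq M y1 d"
      using mem_Y \<open>Y \<noteq> {}\<close> by blast
    then have "(rv M (x \<otimes> x1), rv M (y \<otimes> y1)) \<in> RV_fib M a' \<times> RV_fib M b'"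
      using uw(3) unfolding x(2) y(2) translate[OF x(1) y(1)] by blast
    then have a': "a' = val M (x \<otimes> c)" and b': "b' = val M (y \<otimes> d)"
      using val[OF 1(2,3)] by (auto simp: RV_fib_def val_RV_rv)
    have "E x y"
      unfolding E_def
    proof (intro conjI allI impI x(1) y(1))
      fix x' y' assume xy': "veq M x' c" "veq M y' d"
      have "(rv M (x \<otimes> x'), rv M (y \<otimes> y')) \<in> RV_fib M a' \<times> RV_fib M b'"
        using val[OF xy'] a' b' by (simp add: RV_fib_def val_RV_rv)
      then have "(rv M (x \<otimes> x'), rv M (y \<otimes> y')) \<in> D \<longleftrightarrow>
          (rv M (x \<otimes> x'), rv M (y \<otimes> y')) \<in> (u, w) <#\<^bsub>RV2 M\<^esub> Y"
        unfolding uw(3)[symmetric] by simp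
      then have "(rv M (x \<otimes> x'), rv M (y \<otimes> y')) \<in> D \<longleftrightarrow> (rv M x', rv M y') \<in> Y"
        unfolding x(2) y(2) mem_translate[OF x(1) y(1) val(5,6)[OF xy']] .
      then show "[x \<otimes> x', y \<otimes> y'] \<in> hom D \<longleftrightarrow> [x', y'] \<in> hom Y"
        using val[OF xy'] by (simp add: hom_def)
    qed
    then have "(val M x, val M y) \<in> (\<lambda>(x, y). (val M x, val M y)) ` W"
      unfolding W(3)[symmetric] by (intro image_eqI[of _ _ "(x, y)"]) auto
    then obtain x0 y0 where 0: "(x0, y0) \<in> W" "val M x = val M x0" "val M y = val M y0"
      by auto
    moreover from this have nz: "x0 \<noteq> \<zero>" "y0 \<noteq> \<zero>"
      using W(2) E_nz by blast+
    ultimately have "a' = val M (x0 \<otimes> c)" "b' = val M (y0 \<otimes> d)"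
      using a' b' x(1) y(1) c(1) d(1) by (simp_all add: val_eq_iff veq_mult_cancel integral_iff)
    then show ?thesis using 0(1) by force
  qed
  then have "{(a, b). \<exists>u\<in>carrier (RV M). \<exists>w\<in>carrier (RV M).
           D \<inter> (RV_fib M a \<times> RV_fib M b) = (u, w) <#\<^bsub>RV2 M\<^esub> Y} \<subseteq>
      (\<lambda>(x, y). (val M (x \<otimes> c), val M (y \<otimes> d))) ` W"
    by blast
  then show ?thesis using W(1) finite_surj by blast
qed

end

theorem theorem4p11:
  fixes L :: "('f vf_fun, 'r vf_rel) lang"
    and T :: "('f vf_fun, 'r vf_rel) form set"
    and M :: "('a, 'f, 'r) vf_struct"
    and t :: "'f vf_fun"
    and D Y :: "('a set \<times> 'a set) set"
  assumes "complete_theory TYPE('a) L T"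
    and "expansion_of_ACVF TYPE('a) L T"
    and "C_minimal_theory TYPE('a) L T"
    and "monster_model L T M"
    and "fun_ar L t = Some 0" and "fun_int M t [] \<in> max_ideal M"
    and "definable_RV2 L M D"
    and "fragment L M Y"
    and "finite (Stab M Y)"
  shows "finite {(a, b). a \<in> carrier (Gam M) \<and> b \<in> carrier (Gam M) \<and>
           (\<exists>u\<in>carrier (RV M). \<exists>w\<in>carrier (RV M).
              D \<inter> (RV_fib M a \<times> RV_fib M b) = (u, w) <#\<^bsub>RV2 M\<^esub> Y)}"
proof -
  have L: "expands_vf_lang L" and "is_ACVF M" and C: "C_minimal L M"
    using assms(2-4) unfolding expansion_of_ACVF_def C_minimal_theory_def monster_model_def by blast+
  then have "field (fld M)"
    by (simp add: is_ACVF_def algebraically_closed.axioms(1))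
  then interpret acvf "fld M" M
    using \<open>is_ACVF M\<close> by (intro acvf.intro acvf_axioms.intro) auto
  obtain a b where "a \<in> carrier (Gam M)" "b \<in> carrier (Gam M)" "Y \<subseteq> RV_fib M a \<times> RV_fib M b"
    and Y: "definable_RV2 L M Y" "Y \<noteq> {}"
    using assms(8) unfolding fragment_def by blast
  then show ?thesis
    by (intro finite_subset[OF _ finite_translates[OF L C assms(7) Y(1,2) _ _ _ assms(9)]]) auto
qed

end
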